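(* Let $p\in(0,1)$. If $p<\frac1{\sqrt8}$, then the random Menger sponge $\mathcal M_p$ is totally disconnected almost surely conditioned on non-extinction.
   Context: Random Menger sponge: let $T$ be the set of the $20$ vectors obtained from $\{0,\frac13,\frac23\}^3$ by removing the $7$ vectors having at least two coordinates equal to $\frac13$. Let $f_t(x)=\frac13x+t$ on $\mathbb R^3$ for $t\in T$, and $f_{t_1\dots t_n}=f_{t_1}\circ\dots\circ f_{t_n}$. Give each nonempty finite word over $T$ an independent Bernoulli($p$) label, and let $\mathcal E_n\subset T^n$ be the random set of words $t_1\dots t_n$ such that all of $t_1,\ t_1t_2,\dots,\ t_1\dots t_n$ have label $1$. Then $\mathcal M_p:=\bigcap_{n\ge1}\bigcup_{\mathbf t\in\mathcal E_n}f_{\mathbf t}([0,1]^3)$. Non-extinction is the event that $\mathcal E_n\neq\emptyset$ for all $n$; a property holds "almost surely conditioned on non-extinction" if the event that non-extinction occurs and the property fails has probability $0$. *)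

theory Defs
  imports "HOL-Probability.Probability"
begin

definition menger_digits :: "(real ^ 3) set" where
  "menger_digits =
     {t. \<forall>i. t $ i \<in> {0, 1/3, 2/3}} - {t. 2 \<le> card {i. t $ i = 1/3}}"

definition menger_map :: "real ^ 3 \<Rightarrow> real ^ 3 \<Rightarrow> real ^ 3" where
  "menger_map t x = (1/3) *\<^sub>R x + t"

text \<open>The word \<open>t\<^sub>1 \<dots> t\<^sub>n\<close> is the list \<open>[t\<^sub>1, \<dots>, t\<^sub>n]\<close>; the map of its first letter is applied last.\<close>

definition menger_word_map :: "(real ^ 3) list \<Rightarrow> real ^ 3 \<Rightarrow> real ^ 3" where
  "menger_word_map w = foldr (\<lambda>t g. menger_map t \<circ> g) w id"

definition menger_words :: "(real ^ 3) list set" where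
  "menger_words = {w \<in> lists menger_digits. w \<noteq> []}"

text \<open>Below, \<open>l\<close> is a realisation of the labels; \<open>l w\<close> holds iff the word \<open>w\<close> has label 1.\<close>

definition menger_survivors :: "((real ^ 3) list \<Rightarrow> bool) \<Rightarrow> nat \<Rightarrow> (real ^ 3) list set" where
  "menger_survivors l n =
     {w \<in> lists menger_digits. length w = n \<and> (\<forall>k\<in>{1..n}. l (take k w))}"

definition menger_nonextinct :: "((real ^ 3) list \<Rightarrow> bool) \<Rightarrow> bool" where
  "menger_nonextinct l \<longleftrightarrow> (\<forall>n\<ge>1. menger_survivors l n \<noteq> {})"

text \<open>\<open>cbox 0 1\<close> is the unit cube, since \<open>1 :: real ^ 3\<close> is the all-ones vector.\<close>

definition menger_sponge :: "((real ^ 3) list \<Rightarrow> bool) \<Rightarrow> (real ^ 3) set" where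
  "menger_sponge l =
     (\<Inter>n\<in>{1..}. \<Union>w\<in>menger_survivors l n. menger_word_map w ` cbox 0 1)"

definition totally_disconnected :: "'a::topological_space set \<Rightarrow> bool" where
  "totally_disconnected S \<longleftrightarrow> (\<forall>x\<in>S. connected_component_set S x = {x})"

end

theory Submission
  imports Defs
begin

text \<open>Fix a triadic plane \<open>x\<^sub>i = k / 3\<^sup>n\<close>. A cube of level \<open>n + m\<close> with its lower face on this plane has
  all its last \<open>m\<close> digits in the set of the 8 digits with \<open>t\<^sub>i = 0\<close>, so there are
  \<open>O(8\<^sup>m)\<close> pairs of touching cubes on the two sides of the plane. The two words of such a pair
  already differ in their first \<open>n\<close> letters, so both survive with probability at most
  \<open>p\<^bsup>2m\<^esup>\<close>. As \<open>8 p\<^sup>2 < 1\<close>, almost surely no touching pair survives for some \<open>m\<close>, and then the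
  plane cuts the sponge into two disjoint closed parts. Almost surely this holds for all of the
  countably many triadic planes, and any two distinct points are strictly separated by one of
  them.\<close>

section \<open>Digits and the digits of a face\<close>

lemma menger_digit_component: "t \<in> menger_digits \<Longrightarrow> t $ i \<in> {0, 1/3, 2/3}"
  by (auto simp: menger_digits_def)

lemma inj_components3: "inj (\<lambda>t :: 'a ^ 3. (t $ 1, t $ 2, t $ 3))"
  by (auto simp: inj_on_def vec_eq_iff forall_3)

lemma finite_menger_digits: "finite menger_digits"
proof (rule inj_on_finite)
  show "inj_on (\<lambda>t :: real ^ 3. (t $ 1, t $ 2, t $ 3)) menger_digits"
    by (rule inj_on_subset[OF inj_components3]) simp
  show "(\<lambda>t. (t $ 1, t $ 2, t $ 3)) ` menger_digits \<subseteq> 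
      {0, 1/3, 2/3} \<times> {0, 1/3, 2/3} \<times> {0, 1/3, 2/3 :: real}"
    using menger_digit_component by (intro image_subsetI SigmaI) auto
qed auto

text \<open>Once \<open>t $ i = 0\<close>, the other two coordinates determine \<open>t\<close>.
  They form one of the 3 * 3 pairs except (1/3, 1/3), which would be a removed vector. This 8 is the
  one in the threshold 1 / sqrt 8.\<close>

lemma card_menger_face_digits: "card {t \<in> menger_digits. t $ i = 0} \<le> 8"
proof -
  have "card (UNIV - {i}) = 2" by (simp add: card_Diff_singleton)
  then obtain j k where "j \<noteq> k" "UNIV - {i} = {j, k}" by (metis card_2_iff)
  then have jk: "j \<noteq> k" "UNIV = {i, j, k}" by auto
  let ?S = "{0, 1/3, 2/3 :: real}"
  let ?B = "?S \<times> ?S - {(1/3, 1/3)}"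
  have "card {t \<in> menger_digits. t $ i = 0} \<le> card ?B"
  proof (rule card_inj_on_le)
    show "inj_on (\<lambda>t. (t $ j, t $ k)) {t \<in> menger_digits. t $ i = 0}"
    proof (rule inj_onI)
      fix s t :: "real ^ 3"
      assume "s \<in> {t \<in> menger_digits. t $ i = 0}" "t \<in> {t \<in> menger_digits. t $ i = 0}"
        "(s $ j, s $ k) = (t $ j, t $ k)"
      then have "s $ l = t $ l" if "l \<in> {i, j, k}" for l using that by auto
      then show "s = t" using jk(2) by (metis UNIV_I vec_eq_iff)
    qed
    have "\<not> (t $ j = 1/3 \<and> t $ k = 1/3)" if "t \<in> menger_digits" for t
    proof
      assume "t $ j = 1/3 \<and> t $ k = 1/3"
      then have "{j, k} \<subseteq> {i. t $ i = 1/3}" by auto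
      then have "card {j, k} \<le> card {i. t $ i = 1/3}" by (intro card_mono) auto
      then show False using that jk(1) by (simp add: menger_digits_def)
    qed
    then show "(\<lambda>t. (t $ j, t $ k)) ` {t \<in> menger_digits. t $ i = 0} \<subseteq> ?B"
      using menger_digit_component by (intro image_subsetI DiffI SigmaI) auto
  qed simp
  also have "card ?B = 8"
    by (subst card_Diff_subset) (auto simp: card_cartesian_product)
  finally show ?thesis .
qed

section \<open>Lower corners of the cubes\<close>

definition menger_corner :: "(real ^ 3) list \<Rightarrow> real ^ 3" where
  "menger_corner w = menger_word_map w 0"

lemma menger_corner_Nil [simp]: "menger_corner [] = 0"
  by (simp add: menger_corner_def menger_word_map_def)

lemma menger_corner_Cons [simp]:
  "menger_corner (t # w) = (1/3) *\<^sub>R menger_corner w + t"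
  by (simp add: menger_corner_def menger_word_map_def menger_map_def)

text \<open>A composition of homotheties of ratio 1/3 is again a homothety, so the cube of a word is
  known from the word's length and the image of the origin.\<close>

lemma menger_word_map_eq:
  "menger_word_map w x = (1/3) ^ length w *\<^sub>R x + menger_corner w"
proof (induction w)
  case (Cons t w)
  have "menger_word_map (t # w) x = menger_map t (menger_word_map w x)"
    by (simp add: menger_word_map_def)
  with Cons show ?case by (simp add: menger_map_def algebra_simps)
qed (simp add: menger_word_map_def)

lemma menger_corner_append:
  "menger_corner (v @ w) = menger_corner v + (1/3) ^ length v *\<^sub>R menger_corner w"
  by (induction v) (auto simp: algebra_simps)

lemma menger_corner_nonneg: "w \<in> lists menger_digits \<Longrightarrow> 0 \<le> menger_corner w $ i"
proof (induction w)
  case (Cons t w)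
  then have "0 \<le> t $ i" using menger_digit_component[of t i] by auto
  with Cons show ?case by auto
qed simp

lemma menger_corner_le:
  "w \<in> lists menger_digits \<Longrightarrow> menger_corner w $ i + (1/3) ^ length w \<le> 1"
proof (induction w)
  case (Cons t w)
  then have "t $ i \<le> 2/3" using menger_digit_component[of t i] by auto
  with Cons show ?case by auto
qed simp

lemma menger_corner_less: "w \<in> lists menger_digits \<Longrightarrow> menger_corner w $ i < 1"
  using menger_corner_le[of w i] by (smt (verit) zero_less_power divide_pos_pos)

text \<open>Corner coordinates are finite triadic expansions. Lying on a grid of mesh
  \<open>(1/3) ^ length w\<close>, they can be compared with each other and with triadic planes as
  integers.\<close>

lemma menger_corner_Ints:
  "w \<in> lists menger_digits \<Longrightarrow> 3 ^ length w * menger_corner w $ i \<in> \<int>"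
proof (induction w)
  case (Cons t w)
  then have "t $ i \<in> {0, 1/3, 2/3}" using menger_digit_component[of t i] by auto
  then have "3 * t $ i \<in> {0, 1, 2}" by auto
  then have "3 * t $ i \<in> \<int>" by (metis Ints_0 Ints_1 Ints_numeral empty_iff insert_iff)
  then have "3 ^ length w * menger_corner w $ i + 3 ^ length w * (3 * t $ i) \<in> \<int>"
    using Cons by (intro Ints_add[OF _ Ints_mult[OF Ints_power]]) auto
  then show ?case by (simp add: algebra_simps)
qed simp

text \<open>Uniqueness of triadic expansions of equal length: the tails lie in [0, 1) and so
  contribute less than 1/3, whereas distinct first digits differ by at least 1/3 in some
  coordinate.\<close>

lemma menger_corner_inj:
  assumes "v \<in> lists menger_digits" "w \<in> lists menger_digits"
    and "length v = length w" "menger_corner v = menger_corner w"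
  shows "v = w"
  using assms(3,1,2,4)
proof (induction v w rule: list_induct2)
  case (Cons s v t w)
  have "s $ i = t $ i" for i
  proof -
    have "0 \<le> menger_corner v $ i" "menger_corner v $ i < 1"
      "0 \<le> menger_corner w $ i" "menger_corner w $ i < 1"
      using Cons.prems menger_corner_nonneg menger_corner_less by auto
    moreover have "menger_corner v $ i / 3 + s $ i = menger_corner w $ i / 3 + t $ i"
      using arg_cong[OF Cons.prems(3), of "\<lambda>x. x $ i"] by simp
    ultimately show ?thesis
      using Cons.prems menger_digit_component[of s i] menger_digit_component[of t i] by auto
  qed
  then have "s = t" by (simp add: vec_eq_iff)
  with Cons show ?case by auto
qed simp

text \<open>A corner coordinate is a sum of nonnegative multiples of the digit coordinates, so it
  vanishes only if each term does.\<close>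

lemma menger_corner_face:
  assumes "w \<in> lists menger_digits" "menger_corner w $ i = 0"
  shows "w \<in> lists {t \<in> menger_digits. t $ i = 0}"
  using assms
proof (induction w)
  case (Cons t w)
  have "0 \<le> menger_corner w $ i" using Cons.hyps menger_corner_nonneg[of w i] by auto
  moreover have "0 \<le> t $ i" using Cons.hyps menger_digit_component[of t i] by auto
  moreover have "menger_corner w $ i / 3 + t $ i = 0" using Cons.prems by simp
  ultimately have "menger_corner w $ i = 0" "t $ i = 0" by linarith+
  with Cons show ?case by auto
qed simp

lemma menger_cube_component:
  assumes "y \<in> menger_word_map w ` cbox 0 1"
  shows "menger_corner w $ i \<le> y $ i" "y $ i \<le> menger_corner w $ i + (1/3) ^ length w"
  using assms by (auto simp: menger_word_map_eq mem_box_cart mult_left_le)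

lemma closed_menger_cube: "closed (menger_word_map w ` cbox 0 1)"
proof -
  have "continuous_on (cbox 0 1) (menger_word_map w)"
    unfolding menger_word_map_eq[abs_def] by (intro continuous_intros)
  then show ?thesis by (intro compact_imp_closed compact_continuous_image) auto
qed

section \<open>Pairs of cubes touching across a triadic plane\<close>

definition menger_layer :: "nat \<Rightarrow> 3 \<Rightarrow> real \<Rightarrow> (real ^ 3) list set" where
  "menger_layer N i c =
     {v \<in> lists menger_digits. length v = N \<and> menger_corner v $ i = c}"

text \<open>Closed cubes of equal side meet iff their corners differ by at most one side in every
  coordinate. For \<open>v\<close> over the digits, the grid turns the strict inequality into a
  shift by exactly one side: \<open>u\<close> touches the lower \<open>i\<close>-face of
  \<open>v\<close> from the other side.\<close>

definition menger_neighbours :: "3 \<Rightarrow> (real ^ 3) list \<Rightarrow> (real ^ 3) list set" where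
  "menger_neighbours i v =
     {u \<in> lists menger_digits. length u = length v \<and> menger_corner u $ i < menger_corner v $ i \<and>
        (\<forall>j. \<bar>menger_corner u $ j - menger_corner v $ j\<bar> \<le> (1/3) ^ length v)}"

text \<open>After scaling by \<open>3 ^ n\<close>, both the plane and the corner of the prefix have
  integer position. The suffix contributes their difference, an integer in [0, 1), hence 0.\<close>

lemma menger_layer_decomp:
  assumes v: "v \<in> menger_layer (n + m) i (real_of_int k / 3 ^ n)"
  shows "menger_corner (take n v) $ i = real_of_int k / 3 ^ n"
    and "drop n v \<in> lists {t \<in> menger_digits. t $ i = 0}"
proof -
  define x where "x = menger_corner (drop n v) $ i"
  have len: "length (take n v) = n" and v': "take n v \<in> lists menger_digits"
      "drop n v \<in> lists menger_digits"
    using v by (auto simp: menger_layer_def dest: in_set_takeD in_set_dropD)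
  have "real_of_int k / 3 ^ n = menger_corner (take n v @ drop n v) $ i"
    using v by (simp add: menger_layer_def)
  also have "\<dots> = menger_corner (take n v) $ i + (1/3) ^ n * x"
    using len by (simp add: menger_corner_append x_def del: append_take_drop_id)
  finally have eq: "real_of_int k / 3 ^ n = menger_corner (take n v) $ i + (1/3) ^ n * x" .
  then have "x = real_of_int k - 3 ^ n * menger_corner (take n v) $ i"
    by (simp add: field_simps)
  then have "x \<in> \<int>" using menger_corner_Ints[OF v'(1), of i] len by auto
  then have "x = 0"
    using menger_corner_nonneg[OF v'(2), of i] menger_corner_less[OF v'(2), of i]
    unfolding x_def by (auto elim!: Ints_cases)
  then show "menger_corner (take n v) $ i = real_of_int k / 3 ^ n"
    "drop n v \<in> lists {t \<in> menger_digits. t $ i = 0}"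
    using eq menger_corner_face[OF v'(2)] by (auto simp: x_def)
qed

lemma finite_menger_layer: "finite (menger_layer N i c)"
  by (rule finite_subset[OF _ finite_lists_length_eq[OF finite_menger_digits, of N]])
    (auto simp: menger_layer_def)

text \<open>The first \<open>n\<close> letters are counted crudely, since \<open>n\<close> stays
  fixed while \<open>m\<close> grows; each of the last \<open>m\<close> letters is a face
  digit.\<close>

lemma card_menger_layer:
  "card (menger_layer (n + m) i (real_of_int k / 3 ^ n)) \<le> card menger_digits ^ n * 8 ^ m"
proof -
  let ?D = "{t \<in> menger_digits. t $ i = 0}"
  let ?A = "{w. set w \<subseteq> menger_digits \<and> length w = n}" and ?B = "{w. set w \<subseteq> ?D \<and> length w = m}"
  have fin: "finite ?A" "finite ?B"
    using finite_menger_digits by (auto intro!: finite_lists_length_eq)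
  have "card (menger_layer (n + m) i (real_of_int k / 3 ^ n)) \<le> card (?A \<times> ?B)"
  proof (rule card_inj_on_le)
    show "inj_on (\<lambda>v. (take n v, drop n v)) (menger_layer (n + m) i (real_of_int k / 3 ^ n))"
      by (rule inj_onI) (metis append_take_drop_id prod.inject)
    show "(\<lambda>v. (take n v, drop n v)) ` menger_layer (n + m) i (real_of_int k / 3 ^ n) \<subseteq> ?A \<times> ?B"
    proof (rule image_subsetI)
      fix v assume v: "v \<in> menger_layer (n + m) i (real_of_int k / 3 ^ n)"
      then have "set v \<subseteq> menger_digits" "length v = n + m" by (auto simp: menger_layer_def)
      moreover have "set (drop n v) \<subseteq> ?D" using menger_layer_decomp(2)[OF v] by auto
      ultimately show "(take n v, drop n v) \<in> ?A \<times> ?B"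
        by (auto dest: in_set_takeD)
    qed
  qed (use fin in simp)
  also have "\<dots> = card menger_digits ^ n * card ?D ^ m"
    using finite_menger_digits by (simp add: card_cartesian_product card_lists_length_eq)
  also have "\<dots> \<le> card menger_digits ^ n * 8 ^ m"
    by (intro mult_left_mono power_mono card_menger_face_digits) auto
  finally show ?thesis .
qed

text \<open>Corner differences measured in side lengths are vectors in {-1, 0, 1}^3, and they
  determine the neighbour.\<close>

lemma card_menger_neighbours:
  assumes v: "v \<in> lists menger_digits"
  shows "card (menger_neighbours i v) \<le> 27"
proof -
  let ?N = "length v" and ?S = "{-1, 0, 1 :: real}"
  let ?g = "\<lambda>u. 3 ^ ?N *\<^sub>R (menger_corner u - menger_corner v)"
  let ?f = "\<lambda>u. (?g u $ 1, ?g u $ 2, ?g u $ 3)"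
  have "card (menger_neighbours i v) \<le> card (?S \<times> ?S \<times> ?S)"
  proof (rule card_inj_on_le)
    show "inj_on ?f (menger_neighbours i v)"
    proof (rule inj_onI)
      fix u w assume uw: "u \<in> menger_neighbours i v" "w \<in> menger_neighbours i v" "?f u = ?f w"
      then have "?g u = ?g w" using injD[OF inj_components3, of "?g u" "?g w"] by blast
      then have "menger_corner u = menger_corner w" by simp
      with uw show "u = w" by (intro menger_corner_inj) (auto simp: menger_neighbours_def)
    qed
    have "?g u $ j \<in> ?S" if u: "u \<in> menger_neighbours i v" for u j
    proof -
      have len: "length u = ?N" and u': "u \<in> lists menger_digits"
        and "\<bar>menger_corner u $ j - menger_corner v $ j\<bar> \<le> (1/3) ^ ?N"
        using u by (auto simp: menger_neighbours_def)
      then have "3 ^ ?N * \<bar>menger_corner u $ j - menger_corner v $ j\<bar> \<le> 1"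
        by (simp add: field_simps)
      then have "\<bar>?g u $ j\<bar> \<le> 1" by (simp add: abs_mult)
      moreover have "?g u $ j \<in> \<int>"
        using menger_corner_Ints[OF u', of j] menger_corner_Ints[OF v, of j] len
        by (simp add: right_diff_distrib)
      ultimately obtain z :: int where z: "?g u $ j = real_of_int z" "\<bar>z\<bar> \<le> 1"
        by (auto elim!: Ints_cases)
      then have "z \<in> {-1, 0, 1}" by auto
      then show ?thesis unfolding z(1) by auto
    qed
    then show "?f ` menger_neighbours i v \<subseteq> ?S \<times> ?S \<times> ?S" by blast
  qed simp
  then show ?thesis by (simp add: card_cartesian_product)
qed

lemma finite_menger_neighbours: "finite (menger_neighbours i v)"
  by (rule finite_subset[OF _ finite_lists_length_eq[OF finite_menger_digits, of "length v"]])
    (auto simp: menger_neighbours_def)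

text \<open>The prefix of \<open>v\<close> already has its corner on the plane. Appending letters
  never lowers a corner coordinate, so with the same prefix \<open>u\<close> could not start below
  the plane.\<close>

lemma menger_neighbours_take_neq:
  assumes v: "v \<in> menger_layer (n + m) i (real_of_int k / 3 ^ n)"
    and u: "u \<in> menger_neighbours i v"
  shows "take n u \<noteq> take n v"
proof
  assume eq: "take n u = take n v"
  have len: "length (take n u) = n" "drop n u \<in> lists menger_digits"
    using u v by (auto simp: menger_layer_def menger_neighbours_def dest: in_set_dropD)
  have "menger_corner u $ i = menger_corner (take n u @ drop n u) $ i" by simp
  also have "\<dots> = menger_corner (take n u) $ i + (1/3) ^ n * menger_corner (drop n u) $ i"
    using len by (simp add: menger_corner_append del: append_take_drop_id)
  also have "\<dots> \<ge> menger_corner (take n u) $ i"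
    using menger_corner_nonneg[OF len(2)] by simp
  finally have "menger_corner u $ i \<ge> real_of_int k / 3 ^ n"
    using menger_layer_decomp(1)[OF v] eq by simp
  then show False using u v by (auto simp: menger_layer_def menger_neighbours_def)
qed

text \<open>Words that differ within their first \<open>n\<close> letters share no prefix of length
  above \<open>n\<close>. Shorter prefixes may be shared and are left out, so \<open>2 * m\<close>
  distinct labels remain.\<close>

lemma card_prefixes_diverging:
  assumes "length u = n + m" "length v = n + m" "take n u \<noteq> take n v"
  shows "card ((\<lambda>k. take k u) ` {n<..n + m} \<union> (\<lambda>k. take k v) ` {n<..n + m}) = 2 * m"
proof -
  have inj: "inj_on (\<lambda>k. take k w) {n<..n + m}" if "length w = n + m" for w :: "'a list"
  proof (rule inj_onI)
    fix j k assume "j \<in> {n<..n + m}" "k \<in> {n<..n + m}" "take j w = take k w"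
    then show "j = k" using that by (metis greaterThanAtMost_iff length_take min.absorb2)
  qed
  have "take j u \<noteq> take k v" if "j \<in> {n<..n + m}" "k \<in> {n<..n + m}" for j k
  proof
    assume "take j u = take k v"
    then have "take n (take j u) = take n (take k v)" by simp
    then show False using that assms(3) by (simp add: min_def)
  qed
  then show ?thesis
    using assms inj by (subst card_Un_disjoint) (auto simp: card_image)
qed

section \<open>First-moment bound for surviving pairs\<close>

context prob_space
begin

lemma prob_all_labels:
  assumes indep: "indep_vars (\<lambda>_. count_space UNIV) X W"
    and distr: "\<And>w. w \<in> W \<Longrightarrow> distr M (count_space UNIV) (X w) = measure_pmf (bernoulli_pmf p)"
    and p: "0 \<le> p" "p \<le> 1"
    and J: "J \<subseteq> W" "finite J"
  shows "prob {\<omega> \<in> space M. \<forall>w\<in>J. X w \<omega>} = p ^ card J"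
\<comment> \<open>The empty case is separate because the intersection over it would be
  \<open>UNIV\<close> instead of \<open>space M\<close>.\<close>
proof (cases "J = {}")
  case False
  have rv: "X w \<in> measurable M (count_space UNIV)" if "w \<in> W" for w
    using indep that by (auto simp: indep_vars_def)
  have "{\<omega> \<in> space M. \<forall>w\<in>J. X w \<omega>} = (\<Inter>w\<in>J. X w -` {True} \<inter> space M)"
    using False by auto
  also have "prob \<dots> = (\<Prod>w\<in>J. prob (X w -` {True} \<inter> space M))"
    using indep False J by (intro indep_varsD) auto
  also have "\<dots> = (\<Prod>w\<in>J. p)"
  proof (rule prod.cong)
    fix w assume "w \<in> J"
    then have w: "w \<in> W" using J by auto
    have "prob (X w -` {True} \<inter> space M) = measure (distr M (count_space UNIV) (X w)) {True}"
      using rv[OF w] by (simp add: measure_distr)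
    also have "\<dots> = p" using distr[OF w] p by (simp add: measure_pmf_single)
    finally show "prob (X w -` {True} \<inter> space M) = p" .
  qed simp
  finally show ?thesis by simp
qed (simp add: prob_space)

end

text \<open>The obstruction to cutting along the plane at level \<open>n + m\<close>: two surviving
  cubes that touch across it.\<close>

definition menger_crossing :: "((real ^ 3) list \<Rightarrow> bool) \<Rightarrow> nat \<Rightarrow> nat \<Rightarrow> 3 \<Rightarrow> int \<Rightarrow> bool" where
  "menger_crossing l n m i k \<longleftrightarrow>
     (\<exists>v\<in>menger_layer (n + m) i (real_of_int k / 3 ^ n). \<exists>u\<in>menger_neighbours i v.
        u \<in> menger_survivors l (n + m) \<and> v \<in> menger_survivors l (n + m))"

text \<open>The expected number of crossing pairs decays geometrically in \<open>m\<close>, so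
  crossings at all \<open>m\<close> at once have probability 0.\<close>

lemma (in prob_space) AE_ex_no_menger_crossing:
  assumes indep: "indep_vars (\<lambda>_. count_space UNIV) X menger_words"
    and distr: "\<And>w. w \<in> menger_words \<Longrightarrow>
      distr M (count_space UNIV) (X w) = measure_pmf (bernoulli_pmf p)"
    and p: "0 < p" "p < 1" "p < 1 / sqrt 8"
  shows "AE \<omega> in M. \<exists>m\<ge>1. \<not> menger_crossing (\<lambda>w. X w \<omega>) n m i k"
proof -
  let ?P = "\<lambda>m. Sigma (menger_layer (n + m) i (real_of_int k / 3 ^ n)) (menger_neighbours i)"
  let ?J = "\<lambda>m v u. (\<lambda>k. take k u) ` {n<..n + m} \<union> (\<lambda>k. take k v) ` {n<..n + m}"
  \<comment> \<open>Survival of both words is relaxed to the labels of their prefixes longer than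
    \<open>n\<close>, which are \<open>2 * m\<close> distinct independent labels. Hence
    \<open>E m\<close> contains the crossing event. The \<open>k\<close> bound in \<open>?J\<close>
    is a prefix length, not the plane index.\<close>
  define A where "A m vu = {\<omega> \<in> space M. \<forall>w\<in>?J m (fst vu) (snd vu). X w \<omega>}" for m vu
  define E where "E m = (\<Union>vu\<in>?P m. A m vu)" for m
  \<comment> \<open>At most 27 neighbours for each word of the layer, and all choices of the first
    \<open>n\<close> letters.\<close>
  define K where "K = 27 * real (card menger_digits) ^ n"
  have finP: "finite (?P m)" for m
    using finite_menger_layer finite_menger_neighbours by auto
  have J: "?J m v u \<subseteq> menger_words" 
    if "v \<in> menger_layer (n + m) i (real_of_int k / 3 ^ n)" "u \<in> menger_neighbours i v" for m v u
    using that by (auto simp: menger_words_def menger_layer_def menger_neighbours_def 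
        dest: in_set_takeD)
  have rv: "X w \<in> measurable M (count_space UNIV)" if "w \<in> menger_words" for w
    using indep that by (auto simp: indep_vars_def)
  have A: "A m vu \<in> events" if "vu \<in> ?P m" for m vu
  proof -
    have "{\<omega> \<in> space M. X w \<omega>} \<in> events" if "w \<in> ?J m (fst vu) (snd vu)" for w
    proof -
      have "fst vu \<in> menger_layer (n + m) i (real_of_int k / 3 ^ n)"
        "snd vu \<in> menger_neighbours i (fst vu)"
        using \<open>vu \<in> ?P m\<close> by auto
      then have "w \<in> menger_words" using J that by blast
      then have "X w -` {True} \<inter> space M \<in> events" using rv by (intro measurable_sets) auto
      also have "X w -` {True} \<inter> space M = {\<omega> \<in> space M. X w \<omega>}" by auto
      finally show ?thesis .
    qed
    then show ?thesis unfolding A_def by (intro sets.sets_Collect_finite_All) auto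
  qed
  have probA: "prob (A m vu) = p ^ (2 * m)" if "vu \<in> ?P m" for m vu
  proof -
    obtain v u where vu: "vu = (v, u)" "v \<in> menger_layer (n + m) i (real_of_int k / 3 ^ n)" 
      "u \<in> menger_neighbours i v"
      using \<open>vu \<in> ?P m\<close> by auto
    have "prob (A m vu) = p ^ card (?J m v u)"
      unfolding A_def vu fst_conv snd_conv
      using p J[OF vu(2,3)] by (intro prob_all_labels[OF indep distr]) auto
    also have "card (?J m v u) = 2 * m"
      using vu menger_neighbours_take_neq[OF vu(2,3)]
      by (intro card_prefixes_diverging) (auto simp: menger_layer_def menger_neighbours_def)
    finally show ?thesis .
  qed
  have E: "E m \<in> events" for m
    unfolding E_def using finP A by blast
  have probE: "prob (E m) \<le> K * (8 * p\<^sup>2) ^ m" for m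
  proof -
    have "prob (E m) \<le> (\<Sum>vu\<in>?P m. prob (A m vu))"
      unfolding E_def using finP A by (intro finite_measure_subadditive_finite) auto
    also have "\<dots> = real (card (?P m)) * p ^ (2 * m)"
      using probA by simp
    also have "\<dots> \<le> (K * 8 ^ m) * p ^ (2 * m)"
    proof (rule mult_right_mono)
      have "card (?P m) = (\<Sum>v\<in>menger_layer (n + m) i (real_of_int k / 3 ^ n). 
          card (menger_neighbours i v))"
        using finite_menger_layer finite_menger_neighbours by (intro card_SigmaI) auto
      also have "\<dots> \<le> (\<Sum>v\<in>menger_layer (n + m) i (real_of_int k / 3 ^ n). 27)"
        by (intro sum_mono card_menger_neighbours) (auto simp: menger_layer_def)
      also have "\<dots> \<le> card menger_digits ^ n * 8 ^ m * 27"
        using card_menger_layer[of n m i k] by simp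
      finally have "real (card (?P m)) \<le> real (card menger_digits ^ n * 8 ^ m * 27)"
        by (simp only: of_nat_le_iff)
      then show "real (card (?P m)) \<le> K * 8 ^ m" by (simp add: K_def mult_ac)
    qed (use p in simp)
    also have "\<dots> = K * (8 * p\<^sup>2) ^ m"
      by (simp add: power_mult power_mult_distrib)
    finally show ?thesis .
  qed
  \<comment> \<open>The threshold on \<open>p\<close> is exactly the condition that the ratio
    \<open>8 * p\<^sup>2\<close> is below 1.\<close>
  have "p * sqrt 8 < 1" using p by (simp add: field_simps)
  then have "(p * sqrt 8)\<^sup>2 < 1" using p by (simp add: power_less_one_iff abs_square_less_1)
  then have "8 * p\<^sup>2 < 1" by (simp add: power_mult_distrib)
  then have "(\<lambda>m. K * (8 * p\<^sup>2) ^ m) \<longlonglongrightarrow> K * 0"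
    by (intro tendsto_mult LIMSEQ_power_zero tendsto_const) auto
  then have lim: "(\<lambda>m. K * (8 * p\<^sup>2) ^ m) \<longlonglongrightarrow> 0" by simp
  have "prob (\<Inter>m\<in>{1..}. E m) \<le> 0"
  proof (rule tendsto_lowerbound[OF lim])
    have "prob (\<Inter>m\<in>{1..}. E m) \<le> prob (E m)" if "m \<ge> 1" for m
      using E that by (intro finite_measure_mono) auto
    then show "\<forall>\<^sub>F m in sequentially. prob (\<Inter>m\<in>{1..}. E m) \<le> K * (8 * p\<^sup>2) ^ m"
      using probE by (intro eventually_sequentiallyI[of 1]) (rule order_trans)
  qed simp
  then have "prob (\<Inter>m\<in>{1..}. E m) = 0" by (simp add: measure_le_0_iff)
  moreover have "(\<Inter>m\<in>{1..}. E m) \<in> events" using E by (intro sets.countable_INT) auto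
  ultimately have null: "(\<Inter>m\<in>{1..}. E m) \<in> null_sets M"
    by (intro null_setsI) (auto simp: emeasure_eq_measure)
  show ?thesis
  \<comment> \<open>It suffices to cover the exceptional set by the null set.\<close>
  proof (rule AE_I'[OF null], rule subsetI)
    fix \<omega> assume "\<omega> \<in> {\<omega> \<in> space M. \<not> (\<exists>m\<ge>1. \<not> menger_crossing (\<lambda>w. X w \<omega>) n m i k)}"
    then have \<omega>: "\<omega> \<in> space M" "\<And>m. m \<ge> 1 \<Longrightarrow> menger_crossing (\<lambda>w. X w \<omega>) n m i k" by auto
    show "\<omega> \<in> (\<Inter>m\<in>{1..}. E m)"
    proof
      fix m :: nat assume "m \<in> {1..}"
      then obtain v u where "(v, u) \<in> ?P m"
          "u \<in> menger_survivors (\<lambda>w. X w \<omega>) (n + m)" "v \<in> menger_survivors (\<lambda>w. X w \<omega>) (n + m)"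
        using \<omega>(2)[of m] by (auto simp: menger_crossing_def)
      then have "(v, u) \<in> ?P m" "\<omega> \<in> A m (v, u)"
        using \<omega>(1) by (auto simp: A_def menger_survivors_def)
      then show "\<omega> \<in> E m" unfolding E_def by blast
    qed
  qed
qed

section \<open>Cutting the sponge along triadic planes\<close>

lemma triadic_between:
  fixes a b :: real
  assumes "a < b"
  obtains n :: nat and k :: int where "a < real_of_int k / 3 ^ n" "real_of_int k / 3 ^ n < b"
proof -
  obtain n :: nat where "(1/3) ^ n < b - a"
    using real_arch_pow_inv[of "b - a" "1/3"] assms by auto
  then have n: "1 < (b - a) * 3 ^ n" by (simp add: field_simps)
  \<comment> \<open>The least integer strictly above \<open>a * 3 ^ n\<close>, also when that number
    is itself an integer.\<close>
  let ?k = "\<lfloor>a * 3 ^ n\<rfloor> + 1"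
  have "a * 3 ^ n < real_of_int ?k" "real_of_int ?k \<le> a * 3 ^ n + 1" by linarith+
  moreover from this n have "real_of_int ?k < b * 3 ^ n"
    unfolding left_diff_distrib by linarith
  ultimately show ?thesis by (intro that[of ?k n]) (simp_all add: field_simps)
qed

text \<open>Without a crossing, the surviving cubes on the two sides form disjoint closed sets
  covering the sponge, and a connected set cannot meet both.\<close>

lemma menger_sponge_plane_separates:
  assumes m: "m \<ge> 1" and free: "\<not> menger_crossing l n m i k"
    and C: "connected C" "C \<subseteq> menger_sponge l" "x \<in> C" "y \<in> C"
    and less: "x $ i < real_of_int k / 3 ^ n" "real_of_int k / 3 ^ n < y $ i"
  shows False
proof -
  define N where "N = n + m"
  define c where "c = real_of_int k / 3 ^ n"
  let ?cube = "\<lambda>w. menger_word_map w ` cbox 0 1"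
  define L where "L = {w \<in> menger_survivors l N. menger_corner w $ i + (1/3) ^ N \<le> c}"
  define R where "R = {w \<in> menger_survivors l N. c \<le> menger_corner w $ i}"
  have fin: "finite (menger_survivors l N)"
    by (rule finite_subset[OF _ finite_lists_length_eq[OF finite_menger_digits, of N]])
      (auto simp: menger_survivors_def)
  have surv: "w \<in> lists menger_digits" "length w = N" if "w \<in> menger_survivors l N" for w
    using that by (auto simp: menger_survivors_def)
  \<comment> \<open>The plane belongs to the grid of level \<open>N\<close>, so no cube of that
    level straddles it: as integers, either \<open>b + 1 \<le> a\<close> or
    \<open>a \<le> b\<close>.\<close>
  have LR: "w \<in> L \<union> R" if w: "w \<in> menger_survivors l N" for w
  proof -
    have "3 ^ N * c = real_of_int k * 3 ^ m"
      by (simp add: c_def N_def power_add)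
    then have "3 ^ N * c \<in> \<int>" by simp
    moreover have "3 ^ N * menger_corner w $ i \<in> \<int>"
      using menger_corner_Ints[of w i] surv[OF w] by auto
    ultimately obtain a b :: int
      where ab: "3 ^ N * c = real_of_int a" "3 ^ N * menger_corner w $ i = real_of_int b"
      by (auto elim!: Ints_cases)
    have "b + 1 \<le> a \<or> a \<le> b" by linarith
    then have "3 ^ N * menger_corner w $ i + 1 \<le> 3 ^ N * c \<or> 
        3 ^ N * c \<le> 3 ^ N * menger_corner w $ i"
      unfolding ab by linarith
    then show ?thesis using w by (auto simp: L_def R_def field_simps)
  qed
  have cover: "C \<subseteq> (\<Union>w\<in>L. ?cube w) \<union> (\<Union>w\<in>R. ?cube w)"
  proof
    fix z assume "z \<in> C"
    then have "z \<in> menger_sponge l" using C by auto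
    then obtain w where "w \<in> menger_survivors l N" "z \<in> ?cube w"
      \<comment> \<open>\<open>m \<ge> 1\<close> ensures \<open>N \<ge> 1\<close>, as the sponge
        intersects only levels from 1 on, while \<open>n\<close> may be 0.\<close>
      using m by (fastforce simp: menger_sponge_def N_def)
    then show "z \<in> (\<Union>w\<in>L. ?cube w) \<union> (\<Union>w\<in>R. ?cube w)" using LR by blast
  qed
  have disj: "(\<Union>w\<in>L. ?cube w) \<inter> (\<Union>w\<in>R. ?cube w) = {}"
  proof (rule ccontr)
    assume "\<not> ?thesis"
    then obtain u v z where u: "u \<in> L" "z \<in> ?cube u" and v: "v \<in> R" "z \<in> ?cube v" by blast
    have len: "length u = N" "length v = N" using u v surv by (auto simp: L_def R_def)
    have b: "\<bar>menger_corner u $ j - menger_corner v $ j\<bar> \<le> (1/3) ^ N" for j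
      using menger_cube_component[OF u(2), of j] menger_cube_component[OF v(2), of j]
      unfolding len by linarith
    have pos: "0 < (1/3 :: real) ^ N" by simp
    have "menger_corner u $ i + (1/3) ^ N \<le> c" "c \<le> menger_corner v $ i"
      using u(1) v(1) by (auto simp: L_def R_def)
    \<comment> \<open>\<open>u\<close> ends at or below \<open>c\<close> and \<open>v\<close> starts
      at or above it; corners at most one side apart force both to touch the plane.\<close>
    then have "menger_corner v $ i = c" "menger_corner u $ i < c"
      using b[of i] pos by linarith+
    then have "v \<in> menger_layer N i c" "u \<in> menger_neighbours i v"
      using u(1) v(1) b surv len by (auto simp: menger_layer_def menger_neighbours_def L_def R_def)
    then show False using free u(1) v(1)
      by (auto simp: menger_crossing_def N_def c_def L_def R_def)
  qed
  have "x \<notin> (\<Union>w\<in>R. ?cube w)"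
    using menger_cube_component(1)[of x _ i] less by (force simp: R_def c_def)
  moreover have "y \<notin> (\<Union>w\<in>L. ?cube w)"
    using menger_cube_component(2)[of y _ i] less surv by (force simp: L_def c_def)
  ultimately have "x \<in> (\<Union>w\<in>L. ?cube w)" "y \<in> (\<Union>w\<in>R. ?cube w)"
    using cover C(3,4) by blast+
  then have "(\<Union>w\<in>L. ?cube w) \<inter> C \<noteq> {}" "(\<Union>w\<in>R. ?cube w) \<inter> C \<noteq> {}"
    using C(3,4) by blast+
  moreover have "closed (\<Union>w\<in>L. ?cube w)" "closed (\<Union>w\<in>R. ?cube w)"
    using fin closed_menger_cube by (auto simp: L_def R_def intro!: closed_UN)
  moreover have "(\<Union>w\<in>L. ?cube w) \<inter> (\<Union>w\<in>R. ?cube w) \<inter> C = {}"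
    unfolding disj by simp
  ultimately show False
    using connected_closedD[OF C(1) _ cover] by metis
qed

theorem theorem1p14:
  fixes M :: "'a measure"
    and X :: "(real ^ 3) list \<Rightarrow> 'a \<Rightarrow> bool"
    and p :: real
  assumes "prob_space M"
    and "prob_space.indep_vars M (\<lambda>_. count_space UNIV) X menger_words"
    and "\<And>w. w \<in> menger_words \<Longrightarrow>
           distr M (count_space UNIV) (X w) = measure_pmf (bernoulli_pmf p)"
    and "0 < p" and "p < 1"
    and "p < 1 / sqrt 8"
  shows "AE \<omega> in M. menger_nonextinct (\<lambda>w. X w \<omega>) \<longrightarrow>
           totally_disconnected (menger_sponge (\<lambda>w. X w \<omega>))"
proof -
  interpret prob_space M by fact
  \<comment> \<open>Triadic planes are indexed by countable types, so one null set serves all of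
    them.\<close>
  have "AE \<omega> in M. \<forall>n i k. \<exists>m\<ge>1. \<not> menger_crossing (\<lambda>w. X w \<omega>) n m i k"
    unfolding AE_all_countable using AE_ex_no_menger_crossing[OF assms(2-)] by blast
  then show ?thesis
  proof (rule AE_mp, intro AE_I2 impI)
    fix \<omega>
    let ?S = "menger_sponge (\<lambda>w. X w \<omega>)"
    assume free: "\<forall>n i k. \<exists>m\<ge>1. \<not> menger_crossing (\<lambda>w. X w \<omega>) n m i k"
    have no_less: "\<not> y $ i < z $ i"
      if C: "connected C" "C \<subseteq> ?S" "y \<in> C" "z \<in> C" for C y z i
    proof
      assume "y $ i < z $ i"
      then obtain n k where "y $ i < real_of_int k / 3 ^ n" "real_of_int k / 3 ^ n < z $ i"
        by (rule triadic_between)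
      with free menger_sponge_plane_separates[OF _ _ C] show False by blast
    qed
    show "totally_disconnected ?S"
      unfolding totally_disconnected_def
    proof (intro ballI equalityI subsetI)
      fix x y assume "x \<in> ?S" and y: "y \<in> connected_component_set ?S x"
      then have "x \<in> connected_component_set ?S x" by simp
      \<comment> \<open>The component contains both points, so \<open>no_less\<close> applies in
        both orders.\<close>
      then have "y $ i = x $ i" for i
        using y no_less[OF connected_connected_component connected_component_subset]
        by (metis linorder_less_linear)
      then show "y \<in> {x}" by (simp add: vec_eq_iff)
    qed simp
  qed
qed

end
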